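(* Let $n,d$ be nonnegative integers with $n\ge 2$. Let $\lambda\vdash n$ with $\lambda\ne(n)$. If $n>d$, then $$\frac{F^{(n-1,1)}_d}{f^{(n-1,1)}}\ \ge\ \frac{F^\lambda_d}{f^\lambda}.$$
   Context: For a partition $\lambda\vdash n$, $f^\lambda$ is the number of standard Young tableaux of shape $\lambda$ (equivalently the dimension of the Specht module $S^\lambda$). For $\lambda,\mu\vdash n$, the Kostka number $K_{\lambda,\mu}$ is the number of semistandard Young tableaux of shape $\lambda$ and content $\mu$ (rows weakly increasing, columns strictly increasing, $\mu_1$ ones, $\mu_2$ twos, etc.). A partition of $d$ with $n$ parts, written $\mathbf a\vdash d$, $\#\mathbf a=n$, is a tuple $\mathbf a=(a_1\ge\dots\ge a_n\ge0)$ with sum $d$, zeros allowed as padding. If $\mathbf a=(a_1^{m_1},\dots,a_\ell^{m_\ell})$ with distinct values $a_1,\dots,a_\ell$ (possibly including $0$) and multiplicities $m_j\ge 1$, its metatype $m(\mathbf a)$ is the partition of $n$ obtained by reordering $(m_1,\dots,m_\ell)$ to be nonincreasing. For $\lambda\vdash n$ define $$F^\lambda_d:=\sum_{\mathbf a\vdash d,\ \#\mathbf a=n}K_{\lambda,m(\mathbf a)}.$$ *)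

theory Defs
  imports Complex_Main "HOL-Library.FuncSet"
begin

text \<open>An integer partition is the weakly decreasing list of its positive parts; so the one-row
  partition of \<open>n \<ge> 1\<close> is \<open>[n]\<close>, and the empty partition is \<open>[]\<close>.\<close>

definition is_partition :: "nat list \<Rightarrow> nat \<Rightarrow> bool" where
  "is_partition lam n \<longleftrightarrow> sorted_wrt (\<ge>) lam \<and> (\<forall>x \<in> set lam. x > 0) \<and> sum_list lam = n"

text \<open>Cells are pairs (row, column) in English convention, both counted from \<open>0\<close>.\<close>

definition young_diagram :: "nat list \<Rightarrow> (nat \<times> nat) set" where
  "young_diagram lam = {(i, j). i < length lam \<and> j < lam ! i}"

text \<open>Fillings are extensional functions on the diagram, so that each tableau is counted once.
  Entries are positive: the entry \<open>Suc k\<close> corresponds to the part \<open>mu ! k\<close> of the content.\<close>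

definition syt :: "nat list \<Rightarrow> (nat \<times> nat \<Rightarrow> nat) set" where
  "syt lam = {T \<in> young_diagram lam \<rightarrow>\<^sub>E {1..sum_list lam}.
     bij_betw T (young_diagram lam) {1..sum_list lam} \<and>
     (\<forall>i j j'. (i, j) \<in> young_diagram lam \<longrightarrow> (i, j') \<in> young_diagram lam \<longrightarrow> j < j' \<longrightarrow>
        T (i, j) < T (i, j')) \<and>
     (\<forall>i i' j. (i, j) \<in> young_diagram lam \<longrightarrow> (i', j) \<in> young_diagram lam \<longrightarrow> i < i' \<longrightarrow>
        T (i, j) < T (i', j))}"

definition num_syt :: "nat list \<Rightarrow> nat" where
  "num_syt lam = card (syt lam)"

definition ssyt :: "nat list \<Rightarrow> nat list \<Rightarrow> (nat \<times> nat \<Rightarrow> nat) set" where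
  "ssyt lam mu = {T \<in> young_diagram lam \<rightarrow>\<^sub>E {1..length mu}.
     (\<forall>i j j'. (i, j) \<in> young_diagram lam \<longrightarrow> (i, j') \<in> young_diagram lam \<longrightarrow> j < j' \<longrightarrow>
        T (i, j) \<le> T (i, j')) \<and>
     (\<forall>i i' j. (i, j) \<in> young_diagram lam \<longrightarrow> (i', j) \<in> young_diagram lam \<longrightarrow> i < i' \<longrightarrow>
        T (i, j) < T (i', j)) \<and>
     (\<forall>k < length mu. card {c \<in> young_diagram lam. T c = Suc k} = mu ! k)}"

definition kostka :: "nat list \<Rightarrow> nat list \<Rightarrow> nat" where
  "kostka lam mu = card (ssyt lam mu)"

text \<open>Partitions of \<open>d\<close> with exactly \<open>n\<close> parts, where parts equal to \<open>0\<close> are allowed.\<close>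

definition padded_partitions :: "nat \<Rightarrow> nat \<Rightarrow> nat list set" where
  "padded_partitions n d = {a. length a = n \<and> sorted_wrt (\<ge>) a \<and> sum_list a = d}"

text \<open>The multiplicities of the distinct values of \<open>a\<close> (the value \<open>0\<close> included), in
  nonincreasing order.\<close>

definition metatype :: "nat list \<Rightarrow> nat list" where
  "metatype a = rev (sort (map (count_list a) (remdups a)))"

text \<open>The number \<open>n\<close> of parts is the size of the shape \<open>lam\<close>.\<close>

definition F :: "nat list \<Rightarrow> nat \<Rightarrow> nat" where
  "F lam d = (\<Sum>a \<in> padded_partitions (sum_list lam) d. kostka lam (metatype a))"

text \<open>Finiteness of the sets behind \<^const>\<open>card\<close> and \<^const>\<open>sum\<close> above.\<close>

lemma finite_young_diagram: "finite (young_diagram lam)"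
proof -
  have "young_diagram lam = (SIGMA i:{..<length lam}. {..<lam ! i})"
    by (auto simp: young_diagram_def)
  then show ?thesis by simp
qed

lemma finite_syt: "finite (syt lam)"
proof (rule finite_subset)
  show "syt lam \<subseteq> young_diagram lam \<rightarrow>\<^sub>E {1..sum_list lam}"
    unfolding syt_def by blast
  show "finite (young_diagram lam \<rightarrow>\<^sub>E {1..sum_list lam})"
    by (rule finite_PiE[OF finite_young_diagram]) simp
qed

lemma finite_ssyt: "finite (ssyt lam mu)"
proof (rule finite_subset)
  show "ssyt lam mu \<subseteq> young_diagram lam \<rightarrow>\<^sub>E {1..length mu}"
    unfolding ssyt_def by blast
  show "finite (young_diagram lam \<rightarrow>\<^sub>E {1..length mu})"
    by (rule finite_PiE[OF finite_young_diagram]) simp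
qed

lemma finite_padded_partitions: "finite (padded_partitions n d)"
proof (rule finite_subset)
  show "padded_partitions n d \<subseteq> {a. set a \<subseteq> {..d} \<and> length a = n}"
    by (auto simp: padded_partitions_def intro: member_le_sum_list)
  show "finite {a. set a \<subseteq> {..d} \<and> length a = n}"
    by (rule finite_lists_length_eq) simp
qed

end

theory Submission
  imports Defs "HOL-Library.Multiset"
begin

text \<open>Write \<open>K D mu\<close> for the Kostka number and \<open>f D\<close> for the number of standard tableaux of a shape
  \<open>D\<close>, and let \<open>mu\<close> be a content of size \<open>n\<close> with \<open>l\<close> positive parts. A tableau of shape \<open>(n - 1, 1)\<close> is
  determined by the entry of its second row, which is anything but \<open>1\<close>; so for this shape
  \<open>K\<close> is \<open>l - 1\<close> and \<open>f\<close> is \<open>n - 1\<close>. The theorem therefore follows, by summation over the partitions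
  \<open>a\<close> of \<open>d\<close>, from the inequality
  \<open>(n - 1) * K D mu \<le> (l - 1) * f D\<close> for the shapes \<open>D\<close> with at least two rows and the contents
  \<open>mu\<close> that occur, up to one exception treated at the end (lemma \<open>kostka_num_std_le\<close>).

  The inequality is proved by induction on \<open>l\<close>. Removing the cells with the largest entry, a
  horizontal strip whose size \<open>k\<close> is the smallest part of \<open>mu\<close>, gives
  \<open>K D mu = (\<Sum>E. K E mu')\<close> over the shapes \<open>E\<close> of size \<open>m = n - k\<close> that such a strip leaves (lemma
  \<open>kostka_on_snoc\<close>). On the other side \<open>f D\<close> is at least the sum of \<open>f E\<close> over all shapes
  \<open>E \<subseteq> D\<close> of size \<open>m\<close>, because every standard tableau of \<open>E\<close> extends to \<open>D\<close> (lemma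
  \<open>sum_num_std_ideals_le\<close>). If every \<open>E\<close> satisfies the inequality, then so does \<open>D\<close>, because
  \<open>(l - 2) / (m - 1) \<le> (l - 1) / (n - 1)\<close>; this is where it matters that \<open>k\<close> is the smallest part
  (lemma \<open>ratio_step\<close>).

  The one shape \<open>E\<close> that violates the inequality in general is the single row, for which
  \<open>K = f = 1\<close>. It occurs only if \<open>D\<close> has two rows, the second of length \<open>b \<le> k\<close>. The case \<open>b = 1\<close> is the
  equality above. For \<open>b \<ge> 2\<close> the numbers \<open>f\<close> are so large that the surplus \<open>1\<close> is absorbed: for
  \<open>l = 2\<close> the number \<open>K\<close> is at most \<open>1\<close> while \<open>f D \<ge> n - 1\<close> (lemma \<open>num_std_two_row_ge\<close>), and for
  \<open>l \<ge> 3\<close> the bound \<open>f D \<ge> (\<Sum>E. f E)\<close> can be improved by \<open>m - 1\<close>, since the shape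
  \<open>(m - 1, 1)\<close> lies inside both shapes obtained from \<open>D\<close> by removing a corner
  (lemma \<open>num_std_two_row_surplus\<close>).

  The inequality is false if \<open>D\<close> and \<open>mu\<close> are both \<open>(2, 2)\<close>, where \<open>K = 1\<close> and \<open>f = 2\<close>. The step
  from the content \<open>(2, 2)\<close> to \<open>(2, 2, 2)\<close> would rest on this case, so the induction avoids contents that begin with
  three parts \<open>2\<close>. Here the hypothesis \<open>d < n\<close> enters: if every value is taken at most twice and
  \<open>n \<ge> 6\<close>, then the sum of \<open>a\<close> is at least \<open>n\<close> (lemma \<open>metatype_prefix\<close>). For the shape \<open>(2, 2)\<close> itself the
  exception occurs only in the sum for \<open>d = 2\<close>, where the other term compensates for it
  (lemma \<open>F_2_2_le\<close>).\<close>

section \<open>Tableaux on order ideals and horizontal strips\<close>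

text \<open>Diagrams are treated as finite order ideals of cells rather than as lists of row lengths: removing
  a strip or comparing two shapes is then an operation on sets.\<close>

definition order_ideal :: "(nat \<times> nat) set \<Rightarrow> bool" where
  "order_ideal D \<longleftrightarrow> finite D \<and>
     (\<forall>i j i' j'. (i, j) \<in> D \<longrightarrow> i' \<le> i \<longrightarrow> j' \<le> j \<longrightarrow> (i', j') \<in> D)"

definition tableaux :: "(nat \<times> nat) set \<Rightarrow> nat list \<Rightarrow> (nat \<times> nat \<Rightarrow> nat) set" where
  "tableaux D mu = {T \<in> D \<rightarrow>\<^sub>E {1..length mu}.
     (\<forall>i j j'. (i, j) \<in> D \<longrightarrow> (i, j') \<in> D \<longrightarrow> j < j' \<longrightarrow> T (i, j) \<le> T (i, j')) \<and>
     (\<forall>i i' j. (i, j) \<in> D \<longrightarrow> (i', j) \<in> D \<longrightarrow> i < i' \<longrightarrow> T (i, j) < T (i', j)) \<and>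
     (\<forall>k < length mu. card {c \<in> D. T c = Suc k} = mu ! k)}"

definition kostka_on :: "(nat \<times> nat) set \<Rightarrow> nat list \<Rightarrow> nat" where
  "kostka_on D mu = card (tableaux D mu)"

definition num_std :: "(nat \<times> nat) set \<Rightarrow> nat" where
  "num_std D = kostka_on D (replicate (card D) 1)"

text \<open>The shapes that remain after removal of a horizontal strip of \<open>k\<close> cells, that is, of \<open>k\<close> cells in
  pairwise different columns.\<close>

definition strips :: "(nat \<times> nat) set \<Rightarrow> nat \<Rightarrow> (nat \<times> nat) set set" where
  "strips D k = {E. E \<subseteq> D \<and> order_ideal E \<and> card (D - E) = k \<and>
     (\<forall>i i' j. (i, j) \<in> D - E \<longrightarrow> (i', j) \<in> D - E \<longrightarrow> i = i')}"

definition two_row :: "nat \<Rightarrow> nat \<Rightarrow> (nat \<times> nat) set" where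
  "two_row a b = {(i, j). i = 0 \<and> j < a \<or> i = 1 \<and> j < b}"

lemma order_ideal_finite: "order_ideal D \<Longrightarrow> finite D"
  by (simp add: order_ideal_def)

lemma order_idealD: "order_ideal D \<Longrightarrow> (i, j) \<in> D \<Longrightarrow> i' \<le> i \<Longrightarrow> j' \<le> j \<Longrightarrow> (i', j') \<in> D"
  unfolding order_ideal_def by blast

lemma finite_tableaux: "finite D \<Longrightarrow> finite (tableaux D mu)"
  by (rule finite_subset[of _ "D \<rightarrow>\<^sub>E {1..length mu}"]) (auto simp: tableaux_def intro: finite_PiE)

lemma finite_strips: "order_ideal D \<Longrightarrow> finite (strips D k)"
  by (rule finite_subset[of _ "Pow D"]) (auto simp: strips_def order_ideal_finite)

lemma stripsD:
  assumes "order_ideal D" "E \<in> strips D k"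
  shows "E \<subseteq> D" "order_ideal E" "card E + k = card D"
proof -
  show *: "E \<subseteq> D" "order_ideal E" using assms by (auto simp: strips_def)
  have "card (D - E) = k" using assms by (auto simp: strips_def)
  then show "card E + k = card D"
    using * assms(1) by (metis card_Diff_subset card_mono le_add_diff_inverse order_ideal_finite)
qed

lemma tableaux_restrict:
  assumes D: "order_ideal D" and T: "T \<in> tableaux D (mu @ [k])"
  defines "E \<equiv> {c \<in> D. T c \<le> length mu}"
  shows "E \<in> strips D k" "restrict T E \<in> tableaux E mu"
proof -
  have fn: "T \<in> D \<rightarrow>\<^sub>E {1..Suc (length mu)}"
    and row: "\<And>i j j'. (i, j) \<in> D \<Longrightarrow> (i, j') \<in> D \<Longrightarrow> j < j' \<Longrightarrow> T (i, j) \<le> T (i, j')"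
    and col: "\<And>i i' j. (i, j) \<in> D \<Longrightarrow> (i', j) \<in> D \<Longrightarrow> i < i' \<Longrightarrow> T (i, j) < T (i', j)"
    and cnt: "\<And>m. m < Suc (length mu) \<Longrightarrow> card {c \<in> D. T c = Suc m} = (mu @ [k]) ! m"
    using T by (auto simp: tableaux_def)
  have rng: "T c \<in> {1..Suc (length mu)}" if "c \<in> D" for c using fn that by auto
  have DE: "D - E = {c \<in> D. T c = Suc (length mu)}"
    unfolding E_def using rng by fastforce
  have "order_ideal E"
    unfolding order_ideal_def
  proof (intro conjI allI impI)
    show "finite E" using D by (simp add: E_def order_ideal_finite)
    fix i j i' j' assume ij: "(i, j) \<in> E" "i' \<le> i" "j' \<le> j"
    then have c: "(i, j) \<in> D" "(i', j) \<in> D" "(i', j') \<in> D"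
      using order_idealD[OF D, of i j] by (auto simp: E_def)
    have "T (i', j') \<le> T (i', j)" using row c ij by (cases "j' = j") auto
    also have "\<dots> \<le> T (i, j)" using col[of i' j i] c ij by (cases "i' = i") auto
    also have "\<dots> \<le> length mu" using ij by (simp add: E_def)
    finally show "(i', j') \<in> E" using c by (simp add: E_def)
  qed
  moreover have "card (D - E) = k" unfolding DE using cnt[of "length mu"] by simp
  moreover have "i = i'" if "(i, j) \<in> D - E" "(i', j) \<in> D - E" for i i' j
    using that col[of i j i'] col[of i' j i] unfolding DE by (cases i i' rule: linorder_cases) auto
  ultimately show "E \<in> strips D k" by (auto simp: strips_def E_def)
  have "card {c \<in> E. restrict T E c = Suc m} = mu ! m" if "m < length mu" for m
  proof -
    have "{c \<in> E. restrict T E c = Suc m} = {c \<in> D. T c = Suc m}"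
      using that by (auto simp: E_def)
    then show ?thesis using cnt[of m] that by (simp add: nth_append)
  qed
  then show "restrict T E \<in> tableaux E mu"
    unfolding tableaux_def using row col rng by (auto simp: E_def)
qed

lemma tableaux_extend:
  assumes D: "order_ideal D" and E: "E \<in> strips D k" and S: "S \<in> tableaux E mu"
  defines "T \<equiv> (\<lambda>c\<in>D. if c \<in> E then S c else Suc (length mu))"
  shows "T \<in> tableaux D (mu @ [k])" "{c \<in> D. T c \<le> length mu} = E" "restrict T E = S"
proof -
  have sub: "E \<subseteq> D" and I: "order_ideal E" and ck: "card (D - E) = k"
    and hor: "\<And>i i' j. (i, j) \<in> D - E \<Longrightarrow> (i', j) \<in> D - E \<Longrightarrow> i = i'"
    using E by (auto simp: strips_def)
  have fn: "S \<in> E \<rightarrow>\<^sub>E {1..length mu}"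
    and row: "\<And>i j j'. (i, j) \<in> E \<Longrightarrow> (i, j') \<in> E \<Longrightarrow> j < j' \<Longrightarrow> S (i, j) \<le> S (i, j')"
    and col: "\<And>i i' j. (i, j) \<in> E \<Longrightarrow> (i', j) \<in> E \<Longrightarrow> i < i' \<Longrightarrow> S (i, j) < S (i', j)"
    and cnt: "\<And>m. m < length mu \<Longrightarrow> card {c \<in> E. S c = Suc m} = mu ! m"
    using S by (auto simp: tableaux_def)
  have rng: "1 \<le> S c \<and> S c \<le> length mu" if "c \<in> E" for c using fn that by auto
  have TE: "T c = S c" if "c \<in> E" for c using that sub by (auto simp: T_def)
  have TD: "T c = Suc (length mu)" if "c \<in> D" "c \<notin> E" for c using that by (auto simp: T_def)
  show lev: "{c \<in> D. T c \<le> length mu} = E"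
  proof (intro equalityI subsetI)
    fix c assume "c \<in> {c \<in> D. T c \<le> length mu}"
    then show "c \<in> E" using TD[of c] by (cases "c \<in> E") auto
  qed (use TE rng sub in auto)
  show "restrict T E = S"
    using fn TE by (auto simp: fun_eq_iff restrict_def PiE_def extensional_def)
  have "T (i, j) \<le> T (i, j')" if "(i, j) \<in> D" "(i, j') \<in> D" "j < j'" for i j j'
  proof (cases "(i, j') \<in> E")
    case True
    then have "(i, j) \<in> E" using order_idealD[OF I True, of i j] that by simp
    then show ?thesis using True TE row that by simp
  next
    case False
    then show ?thesis using that TD[of "(i, j')"] TE[of "(i, j)"] rng[of "(i, j)"] TD[of "(i, j)"]
      by (cases "(i, j) \<in> E") auto
  qed
  moreover have "T (i, j) < T (i', j)" if "(i, j) \<in> D" "(i', j) \<in> D" "i < i'" for i i' j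
  proof (cases "(i', j) \<in> E")
    case True
    then have "(i, j) \<in> E" using order_idealD[OF I True, of i j] that by simp
    then show ?thesis using True TE col that by simp
  next
    case False
    then have "(i, j) \<in> E" using hor[of i j i'] that by auto
    then show ?thesis using False that TD[of "(i', j)"] TE[of "(i, j)"] rng[of "(i, j)"] by auto
  qed
  moreover have "card {c \<in> D. T c = Suc m} = (mu @ [k]) ! m" if "m < Suc (length mu)" for m
  proof (cases "m = length mu")
    case True
    have "{c \<in> D. T c = Suc m} = D - E"
    proof (intro equalityI subsetI)
      fix c assume "c \<in> {c \<in> D. T c = Suc m}"
      then show "c \<in> D - E" using TE[of c] rng[of c] True by auto
    qed (use TD True in auto)
    then show ?thesis using True ck by simp
  next
    case False
    have "{c \<in> D. T c = Suc m} = {c \<in> E. S c = Suc m}"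
    proof (intro equalityI subsetI)
      fix c assume "c \<in> {c \<in> D. T c = Suc m}"
      then show "c \<in> {c \<in> E. S c = Suc m}" using TE[of c] TD[of c] False that
        by (cases "c \<in> E") auto
    qed (use TE sub in auto)
    then show ?thesis using False cnt[of m] that by (simp add: nth_append)
  qed
  moreover have "T \<in> D \<rightarrow>\<^sub>E {1..Suc (length mu)}"
    using rng by (fastforce simp: T_def)
  ultimately show "T \<in> tableaux D (mu @ [k])" by (auto simp: tableaux_def)
qed

text \<open>The cells with the largest entry form a horizontal strip: two of them in one column would violate
  strictness. Conversely, any tableau on the rest extends uniquely by putting the largest entry into
  the strip. Iterated, this is the description of semistandard tableaux as chains of shapes.\<close>

lemma kostka_on_snoc:
  assumes D: "order_ideal D"
  shows "kostka_on D (mu @ [k]) = (\<Sum>E\<in>strips D k. kostka_on E mu)"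
proof -
  define g where "g T = (let E = {c \<in> D. T c \<le> length mu} in (E, restrict T E))"
    for T :: "nat \<times> nat \<Rightarrow> nat"
  define h where "h = (\<lambda>(E, S). \<lambda>c\<in>D. if c \<in> E then S c else Suc (length mu))"
  have "bij_betw g (tableaux D (mu @ [k])) (SIGMA E:strips D k. tableaux E mu)"
  proof (rule bij_betw_byWitness[where f' = h])
    show "\<forall>T\<in>tableaux D (mu @ [k]). h (g T) = T"
    proof
      fix T assume "T \<in> tableaux D (mu @ [k])"
      then have "T \<in> D \<rightarrow>\<^sub>E {1..Suc (length mu)}" by (simp add: tableaux_def)
      then have "\<And>c. c \<notin> D \<Longrightarrow> T c = undefined"
        and "\<And>c. c \<in> D \<Longrightarrow> \<not> T c \<le> length mu \<Longrightarrow> T c = Suc (length mu)"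
        by (auto simp: PiE_def extensional_def Pi_iff le_Suc_eq)
      then show "h (g T) = T"
        by (auto simp: g_def h_def Let_def fun_eq_iff restrict_def)
    qed
    show "\<forall>p\<in>(SIGMA E:strips D k. tableaux E mu). g (h p) = p"
      using tableaux_extend[OF D] by (auto simp: g_def h_def Let_def)
    show "g ` tableaux D (mu @ [k]) \<subseteq> (SIGMA E:strips D k. tableaux E mu)"
      using tableaux_restrict[OF D] by (auto simp: g_def Let_def)
    show "h ` (SIGMA E:strips D k. tableaux E mu) \<subseteq> tableaux D (mu @ [k])"
      using tableaux_extend(1)[OF D] by (auto simp: h_def)
  qed
  then have "kostka_on D (mu @ [k]) = card (SIGMA E:strips D k. tableaux E mu)"
    unfolding kostka_on_def by (rule bij_betw_same_card)
  also have "\<dots> = (\<Sum>E\<in>strips D k. kostka_on E mu)"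
    unfolding kostka_on_def
  proof (rule card_SigmaI)
    show "\<forall>E\<in>strips D k. finite (tableaux E mu)"
      using stripsD(2)[OF D] by (auto intro: finite_tableaux order_ideal_finite)
  qed (rule finite_strips[OF D])
  finally show ?thesis .
qed


lemma kostka_on_Nil: "kostka_on D [] = (if D = {} then 1 else 0)"
  by (auto simp: kostka_on_def tableaux_def PiE_eq_empty_iff)

text \<open>With a single letter at hand no column can be strictly increasing over two cells.\<close>

lemma kostka_on_singleton:
  assumes "order_ideal D" "(1, 0) \<in> D"
  shows "kostka_on D [k] = 0"
proof -
  have "(0, 0) \<in> D" using order_idealD[OF assms, of 0 0] by simp
  then have "{} \<notin> strips D k" using assms by (auto simp: strips_def)
  then have "kostka_on E [] = 0" if "E \<in> strips D k" for E
    using that by (auto simp: kostka_on_Nil)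
  then show ?thesis using kostka_on_snoc[OF assms(1), of "[]" k] by simp
qed

section \<open>Shapes with at most two rows\<close>

lemma mem_two_row [simp]: "(i, j) \<in> two_row a b \<longleftrightarrow> i = 0 \<and> j < a \<or> i = 1 \<and> j < b"
  by (simp add: two_row_def)

lemma two_row_eq_Un: "two_row a b = Pair 0 ` {..<a} \<union> Pair 1 ` {..<b}"
  by auto

lemma card_two_row [simp]: "card (two_row a b) = a + b"
  unfolding two_row_eq_Un by (subst card_Un_disjoint) (auto simp: card_image inj_on_def)

lemma order_ideal_two_row: "b \<le> a \<Longrightarrow> order_ideal (two_row a b)"
  unfolding order_ideal_def
  by (intro conjI) (simp add: two_row_eq_Un, fastforce)

lemma two_row_subset_iff [simp]: "two_row x y \<subseteq> two_row a b \<longleftrightarrow> x \<le> a \<and> y \<le> b"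
proof
  assume sub: "two_row x y \<subseteq> two_row a b"
  have "j < a" if "j < x" for j using subsetD[OF sub, of "(0, j)"] that by simp
  moreover have "j < b" if "j < y" for j using subsetD[OF sub, of "(1, j)"] that by simp
  ultimately show "x \<le> a \<and> y \<le> b" by (meson not_le less_irrefl)
qed auto

lemma two_row_eq_iff [simp]: "two_row x y = two_row a b \<longleftrightarrow> x = a \<and> y = b"
  by (metis two_row_subset_iff order_antisym order_refl)

lemma downset_nat:
  fixes A :: "nat set"
  assumes "finite A" "\<And>x y. x \<in> A \<Longrightarrow> y \<le> x \<Longrightarrow> y \<in> A"
  shows "A = {..<card A}"
proof (cases "A = {}")
  case False
  then have "A = {..Max A}" using assms by (auto intro: Max_ge Max_in)
  then show ?thesis by (metis card_atMost lessThan_Suc_atMost)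
qed simp

lemma order_ideal_eq_two_row:
  assumes D: "order_ideal D" and no: "(2, 0) \<notin> D"
  obtains a b where "b \<le> a" "D = two_row a b"
proof -
  define row where "row i = {j. (i, j) \<in> D}" for i :: nat
  have fin: "finite (row i)" for i
    by (rule finite_subset[of _ "snd ` D"])
       (use D in \<open>force simp: row_def order_ideal_finite\<close>)+
  have "row i = {..<card (row i)}" for i
    by (rule downset_nat[OF fin]) (use order_idealD[OF D, of i _ i] in \<open>auto simp: row_def\<close>)
  then have rows: "(i, j) \<in> D \<longleftrightarrow> j < card (row i)" for i j
    by (metis lessThan_iff mem_Collect_eq row_def)
  have small: "i = 0 \<or> i = 1" if "(i, j) \<in> D" for i j
    using order_idealD[OF D that, of 2 0] no by fastforce
  have "D = two_row (card (row 0)) (card (row 1))"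
    using small rows by (fastforce simp: two_row_def)
  moreover have "card (row 1) \<le> card (row 0)"
    by (rule card_mono[OF fin]) (use order_idealD[OF D, of 1 _ 0] in \<open>auto simp: row_def\<close>)
  ultimately show ?thesis using that by blast
qed

lemma order_ideal_eq_row:
  assumes D: "order_ideal D" and "(1, 0) \<notin> D"
  shows "D = two_row (card D) 0"
proof -
  have "(2, 0) \<notin> D" using order_idealD[OF D, of 2 0 1 0] assms(2) by auto
  then obtain a b where ab: "b \<le> a" "D = two_row a b" using order_ideal_eq_two_row[OF D] by blast
  then have "b = 0" using assms(2) by simp
  then show ?thesis using ab by simp
qed

text \<open>The difference of the shapes occupies the columns \<open>{x..<a}\<close> of the first row and \<open>{y..<b}\<close> of the
  second; as \<open>y \<le> x\<close> and \<open>b \<le> a\<close>, these share no column exactly if \<open>b \<le> x\<close>.\<close>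

lemma two_row_in_strips_iff:
  assumes "b \<le> a" "y \<le> x"
  shows "two_row x y \<in> strips (two_row a b) k \<longleftrightarrow> x \<le> a \<and> y \<le> b \<and> b \<le> x \<and> x + y + k = a + b"
proof (cases "x \<le> a \<and> y \<le> b")
  case True
  have "card (two_row a b - two_row x y) = a + b - (x + y)"
    using True assms by (subst card_Diff_subset) (auto simp: order_ideal_finite order_ideal_two_row)
  moreover have "(\<forall>i i' j. (i, j) \<in> two_row a b - two_row x y \<longrightarrow> (i', j) \<in> two_row a b - two_row x y
      \<longrightarrow> i = i') \<longleftrightarrow> b \<le> x" (is "?hor \<longleftrightarrow> _")
  proof
    assume ?hor
    then have "(0, x) \<in> two_row a b - two_row x y \<longrightarrow> (1, x) \<in> two_row a b - two_row x y \<longrightarrow> (0::nat) = 1"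
      by blast
    then show "b \<le> x" using assms by auto
  qed auto
  moreover have "two_row x y \<subseteq> two_row a b" "order_ideal (two_row x y)"
    using True assms by (auto simp: order_ideal_two_row)
  ultimately have "two_row x y \<in> strips (two_row a b) k \<longleftrightarrow> a + b - (x + y) = k \<and> b \<le> x"
    unfolding strips_def mem_Collect_eq by argo
  then show ?thesis using True by auto
next
  case False
  then show ?thesis by (auto simp: strips_def)
qed

lemma strips_two_row:
  assumes "b \<le> a" "E \<in> strips (two_row a b) k"
  obtains x y where "y \<le> x" "x \<le> a" "y \<le> b" "b \<le> x" "x + y + k = a + b" "E = two_row x y"
proof -
  have E: "order_ideal E" "E \<subseteq> two_row a b"
    using stripsD[OF order_ideal_two_row[OF assms(1)] assms(2)] by auto
  then have "(2, 0) \<notin> E" by auto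
  then obtain x y where "y \<le> x" "E = two_row x y" using order_ideal_eq_two_row[OF E(1)] by blast
  then show ?thesis using that assms by (auto simp: two_row_in_strips_iff)
qed

lemma kostka_on_row: "sum_list mu = m \<Longrightarrow> kostka_on (two_row m 0) mu = 1"
proof (induction mu arbitrary: m rule: rev_induct)
  case Nil
  then show ?case by (simp add: kostka_on_Nil two_row_eq_Un)
next
  case (snoc k mu)
  then have m: "m = sum_list mu + k" by simp
  have "strips (two_row m 0) k = {two_row (sum_list mu) 0}"
  proof (intro equalityI subsetI)
    fix E assume "E \<in> strips (two_row m 0) k"
    then show "E \<in> {two_row (sum_list mu) 0}"
      by (rule strips_two_row[OF le0]) (simp add: m)
  qed (simp add: m two_row_in_strips_iff)
  then show ?case by (simp add: kostka_on_snoc order_ideal_two_row snoc.IH)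
qed

lemma length_le_sum_list: "\<forall>x\<in>set xs. 0 < x \<Longrightarrow> length xs \<le> sum_list xs" for xs :: "nat list"
  by (induction xs) auto

text \<open>This count is what makes the shape \<open>(n - 1, 1)\<close> extremal. Removing a strip either removes the cell
  of the second row and leaves a row, which has exactly one tableau, or leaves a shape of the same
  kind; so each part after the first contributes \<open>1\<close>.\<close>

lemma kostka_on_two_row_1:
  assumes "\<forall>x\<in>set mu. x > 0" "sum_list mu = Suc a" "a \<ge> 1"
  shows "kostka_on (two_row a 1) mu = length mu - 1"
  using assms
proof (induction mu arbitrary: a rule: rev_induct)
  case (snoc k mu)
  have I: "order_ideal (two_row a 1)" using snoc.prems by (intro order_ideal_two_row)
  have "length mu \<le> sum_list mu" using snoc.prems(1) by (intro length_le_sum_list) auto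
  moreover have "length mu > 0 \<longleftrightarrow> mu \<noteq> []" by simp
  ultimately consider "mu = []" | "mu \<noteq> []" "sum_list mu = 1" | "mu \<noteq> []" "sum_list mu \<ge> 2"
    by linarith
  then show ?case
  proof cases
    case 1
    then show ?thesis using kostka_on_singleton[OF I] by simp
  next
    case 2
    then have "length mu = 1"
      using \<open>length mu \<le> sum_list mu\<close> by (cases mu) auto
    \<comment> \<open>The shape with rows \<open>0\<close> and \<open>1\<close> is not an order ideal, so only the row remains.\<close>
    have "strips (two_row a 1) k = {two_row 1 0}"
    proof (intro equalityI subsetI)
      fix E assume "E \<in> strips (two_row a 1) k"
      then show "E \<in> {two_row 1 0}"
        by (rule strips_two_row[OF snoc.prems(3)]) (use snoc.prems 2 in auto)
    qed (use snoc.prems 2 in \<open>auto simp: two_row_in_strips_iff\<close>)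
    then show ?thesis
      unfolding kostka_on_snoc[OF I] using \<open>length mu = 1\<close> 2 by (simp add: kostka_on_row)
  next
    case 3
    define m where "m = sum_list mu - 1"
    then have m: "sum_list mu = Suc m" "m \<ge> 1" using 3 by auto
    have k: "k \<ge> 1" "a = m + k" using snoc.prems m by auto
    have "strips (two_row a 1) k = {two_row (Suc m) 0, two_row m 1}"
    proof (intro equalityI subsetI)
      fix E assume "E \<in> strips (two_row a 1) k"
      then obtain x y where "y \<le> 1" "x + y + k = a + 1" "E = two_row x y"
        by (rule strips_two_row[OF snoc.prems(3)])
      then show "E \<in> {two_row (Suc m) 0, two_row m 1}" using k by (cases y) auto
    qed (use k m in \<open>auto simp: two_row_in_strips_iff\<close>)
    then have "kostka_on (two_row a 1) (mu @ [k]) = kostka_on (two_row (Suc m) 0) mu + kostka_on (two_row m 1) mu"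
      unfolding kostka_on_snoc[OF I] by simp
    also have "\<dots> = 1 + (length mu - 1)"
      using snoc.IH[of m] snoc.prems m kostka_on_row[of mu "Suc m"] by simp
    finally show ?thesis using 3 by (cases mu) auto
  qed
qed simp

section \<open>Counting standard tableaux\<close>

lemma num_std_row: "num_std (two_row a 0) = 1"
  by (simp add: num_std_def kostka_on_row sum_list_replicate)

lemma num_std_two_row_1: "a \<ge> 1 \<Longrightarrow> num_std (two_row a 1) = a"
  unfolding num_std_def by (subst kostka_on_two_row_1[where a = a]) (auto simp: sum_list_replicate)

text \<open>One cell is always a horizontal strip, so this is the branching rule: remove the cell with the
  largest entry.\<close>

lemma num_std_branching:
  assumes D: "order_ideal D" and "D \<noteq> {}"
  shows "num_std D = (\<Sum>E\<in>strips D 1. num_std E)"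
proof -
  have "card D > 0" using assms by (simp add: order_ideal_finite card_gt_0_iff)
  then obtain m where m: "card D = Suc m" by (cases "card D") auto
  have "replicate (card D) 1 = replicate m (1::nat) @ [1]"
    unfolding m by (simp add: replicate_append_same)
  then have "num_std D = (\<Sum>E\<in>strips D 1. kostka_on E (replicate m 1))"
    by (simp add: num_std_def kostka_on_snoc[OF D])
  also have "\<dots> = (\<Sum>E\<in>strips D 1. num_std E)"
  proof (rule sum.cong)
    fix E assume "E \<in> strips D 1"
    then have "card E = m" using stripsD(3)[OF D, of E 1] m by simp
    then show "kostka_on E (replicate m 1) = num_std E" by (simp add: num_std_def)
  qed simp
  finally show ?thesis .
qed

text \<open>A cell of \<open>D - E\<close> whose coordinate sum is maximal is a corner of \<open>D\<close>.\<close>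

lemma exists_corner:
  assumes D: "order_ideal D" and E: "order_ideal E" "E \<subset> D"
  shows "\<exists>D'\<in>strips D 1. E \<subseteq> D'"
proof -
  have "finite (D - E)" "D - E \<noteq> {}" using D E by (auto simp: order_ideal_finite)
  then have "Max ((\<lambda>(i, j). i + j) ` (D - E)) \<in> (\<lambda>(i, j). i + j) ` (D - E)"
    by (intro Max_in) auto
  then obtain c where c: "c \<in> D - E"
    and c_max: "Max ((\<lambda>(i, j). i + j) ` (D - E)) = (\<lambda>(i, j). i + j) c" by blast
  have max: "fst c' + snd c' \<le> fst c + snd c" if "c' \<in> D - E" for c'
    using Max_ge[of "(\<lambda>(i, j). i + j) ` (D - E)" "(\<lambda>(i, j). i + j) c'"] that
      \<open>finite (D - E)\<close> unfolding c_max by (auto simp: case_prod_beta)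
  have "order_ideal (D - {c})"
    unfolding order_ideal_def
  proof (intro conjI allI impI)
    show "finite (D - {c})" using D by (simp add: order_ideal_finite)
    fix i j i' j' assume ij: "(i, j) \<in> D - {c}" "i' \<le> i" "j' \<le> j"
    have "(i', j') \<noteq> c"
    proof
      assume eq: "(i', j') = c"
      then have "(i, j) \<in> D - E" using order_idealD[OF E(1), of i j i' j'] ij c by auto
      then show False using max[of "(i, j)"] ij eq by auto
    qed
    then show "(i', j') \<in> D - {c}" using order_idealD[OF D, of i j i' j'] ij by auto
  qed
  moreover have "D - (D - {c}) = {c}" using c by auto
  ultimately show ?thesis using c E by (intro bexI[of _ "D - {c}"]) (auto simp: strips_def)
qed

definition ideals :: "(nat \<times> nat) set \<Rightarrow> nat \<Rightarrow> (nat \<times> nat) set set" where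
  "ideals D m = {E. E \<subseteq> D \<and> order_ideal E \<and> card E = m}"

lemma finite_ideals: "order_ideal D \<Longrightarrow> finite (ideals D m)"
  by (rule finite_subset[of _ "Pow D"]) (auto simp: ideals_def order_ideal_finite)

lemma strips_subset_ideals:
  assumes "order_ideal D" "card D = m + k"
  shows "strips D k \<subseteq> ideals D m"
  using stripsD[OF assms(1)] assms(2) unfolding ideals_def by fastforce

text \<open>Standard tableaux of distinct subshapes of one size extend to distinct standard tableaux of \<open>D\<close>.
  In the induction every subshape lies below at least one shape obtained by removing a corner.\<close>

lemma sum_num_std_ideals_le:
  assumes "order_ideal D" "card D = m + k"
  shows "(\<Sum>E\<in>ideals D m. num_std E) \<le> num_std D"
  using assms
proof (induction k arbitrary: D)
  case 0
  have "ideals D m = {D}"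
  proof (intro equalityI subsetI)
    fix E assume "E \<in> ideals D m"
    then show "E \<in> {D}"
      using card_subset_eq[OF order_ideal_finite[OF 0(1)], of E] 0(2) by (simp add: ideals_def)
  qed (use 0 in \<open>simp add: ideals_def\<close>)
  then show ?case by simp
next
  case (Suc k)
  have D': "order_ideal D'" "card D' = m + k" if "D' \<in> strips D 1" for D'
    using stripsD[OF Suc.prems(1) that] Suc.prems(2) by auto
  have "(\<Sum>E\<in>ideals D m. num_std E)
      \<le> (\<Sum>(D', E)\<in>(SIGMA D':strips D 1. ideals D' m). num_std E)"
  proof (rule sum_le_included[where i = snd])
    show "\<forall>E\<in>ideals D m. \<exists>p\<in>(SIGMA D':strips D 1. ideals D' m).
        snd p = E \<and> num_std E \<le> (case p of (D', E) \<Rightarrow> num_std E)"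
    proof
      fix E assume E: "E \<in> ideals D m"
      then have "E \<noteq> D" "E \<subseteq> D" "order_ideal E" using Suc.prems(2) by (auto simp: ideals_def)
      then have "\<exists>D'\<in>strips D 1. E \<subseteq> D'" by (intro exists_corner[OF Suc.prems(1)]) blast+
      then obtain D' where "D' \<in> strips D 1" "E \<subseteq> D'" by blast
      then show "\<exists>p\<in>(SIGMA D':strips D 1. ideals D' m).
          snd p = E \<and> num_std E \<le> (case p of (D', E) \<Rightarrow> num_std E)"
        using E by (intro bexI[of _ "(D', E)"]) (auto simp: ideals_def)
    qed
  qed (use Suc.prems D' in \<open>auto simp: finite_ideals finite_strips\<close>)
  also have "\<dots> = (\<Sum>D'\<in>strips D 1. \<Sum>E\<in>ideals D' m. num_std E)"
    using Suc.prems D' by (subst sum.Sigma) (auto simp: finite_ideals finite_strips)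
  also have "\<dots> \<le> (\<Sum>D'\<in>strips D 1. num_std D')"
    by (intro sum_mono Suc.IH D')
  also have "\<dots> = num_std D"
    using num_std_branching[OF Suc.prems(1)] Suc.prems(2) by fastforce
  finally show ?case .
qed

lemma strips_two_row_1:
  assumes "b < a" "b > 0"
  shows "strips (two_row a b) 1 = {two_row (a - 1) b, two_row a (b - 1)}"
proof (intro equalityI subsetI)
  fix E assume "E \<in> strips (two_row a b) 1"
  then obtain x y where "x \<le> a" "y \<le> b" "x + y + 1 = a + b" "E = two_row x y"
    by (rule strips_two_row[rotated]) (use assms in auto)
  moreover from this have "x = a - 1 \<and> y = b \<or> x = a \<and> y = b - 1" by linarith
  ultimately show "E \<in> {two_row (a - 1) b, two_row a (b - 1)}" by auto
qed (use assms in \<open>auto simp: two_row_in_strips_iff\<close>)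

lemma num_std_two_row_step:
  assumes "b < a" "b > 0"
  shows "num_std (two_row a b) = num_std (two_row (a - 1) b) + num_std (two_row a (b - 1))"
proof -
  have "(0, 0) \<in> two_row a b" using assms by simp
  then have "two_row a b \<noteq> {}" by blast
  then have "num_std (two_row a b) = (\<Sum>E\<in>{two_row (a - 1) b, two_row a (b - 1)}. num_std E)"
    using assms num_std_branching[OF order_ideal_two_row] strips_two_row_1 by simp
  also have "\<dots> = num_std (two_row (a - 1) b) + num_std (two_row a (b - 1))"
    using assms by (subst sum.insert) auto
  finally show ?thesis .
qed

lemma num_std_two_row_mono:
  assumes "b' \<le> b" "b \<le> a"
  shows "num_std (two_row a b') \<le> num_std (two_row a b)"
proof -
  have "two_row a b' \<in> ideals (two_row a b) (a + b')"
    using assms by (auto simp: ideals_def order_ideal_two_row)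
  then have "num_std (two_row a b') \<le> (\<Sum>E\<in>ideals (two_row a b) (a + b'). num_std E)"
    using assms by (intro member_le_sum) (auto simp: finite_ideals order_ideal_two_row)
  also have "\<dots> \<le> num_std (two_row a b)"
    using assms by (intro sum_num_std_ideals_le[where k = "b - b'"]) (auto simp: order_ideal_two_row)
  finally show ?thesis .
qed

text \<open>For two rows of lengths \<open>a\<close> and \<open>b\<close> the bound \<open>2 * a - 1\<close> is at least the size of the shape minus
  \<open>1\<close>. It fails for \<open>a = b = 2\<close>, where there are only two standard tableaux; this is the source of the
  exceptional pair.\<close>

lemma num_std_two_row_ge:
  assumes "2 \<le> b" "b \<le> a" "3 \<le> a"
  shows "2 * a - 1 \<le> num_std (two_row a b)"
proof -
  have "2 * a - 1 \<le> num_std (two_row a 2)"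
    using assms(3)
  proof (induction a rule: nat_induct_at_least)
    case base
    have "2 \<le> num_std (two_row 2 2)"
      using num_std_two_row_mono[of 1 2 2] num_std_two_row_1[of 2] by simp
    then show ?case using num_std_two_row_step[of 2 3] num_std_two_row_1[of 3] by simp
  next
    case (Suc a)
    then show ?case using num_std_two_row_step[of 2 "Suc a"] num_std_two_row_1[of "Suc a"] by simp
  qed
  then show ?thesis using num_std_two_row_mono[of 2 b a] assms by linarith
qed

text \<open>The two shapes obtained by removing a corner together contain every subshape of size \<open>m\<close>, and both
  contain the shape \<open>(m - 1, 1)\<close>. The latter is hence counted twice, which adds the number \<open>m - 1\<close> of
  its standard tableaux.\<close>

lemma num_std_two_row_surplus:
  assumes "2 \<le> b" "b < a" "2 \<le> m" "m \<le> a" "m < a + b"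
  shows "(\<Sum>E\<in>ideals (two_row a b) m. num_std E) + (m - 1) \<le> num_std (two_row a b)"
proof -
  let ?D = "two_row a b" and ?A = "two_row (a - 1) b" and ?B = "two_row a (b - 1)"
  let ?E = "two_row (m - 1) 1"
  have I: "order_ideal ?D" "order_ideal ?A" "order_ideal ?B"
    using assms by (auto simp: order_ideal_two_row)
  have "ideals ?D m \<subseteq> ideals ?A m \<union> ideals ?B m"
  proof
    fix E assume E: "E \<in> ideals ?D m"
    then have "E \<noteq> ?D" "E \<subseteq> ?D" "order_ideal E" using assms by (auto simp: ideals_def)
    then have "\<exists>D'\<in>strips ?D 1. E \<subseteq> D'" by (intro exists_corner[OF I(1)]) blast+
    also have "strips ?D 1 = {?A, ?B}" using assms by (intro strips_two_row_1) auto
    finally show "E \<in> ideals ?A m \<union> ideals ?B m" using E unfolding ideals_def by blast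
  qed
  then have "(\<Sum>E\<in>ideals ?D m. num_std E) \<le> (\<Sum>E\<in>ideals ?A m \<union> ideals ?B m. num_std E)"
    using I by (intro sum_mono2) (auto simp: finite_ideals)
  moreover have "?E \<in> ideals ?A m \<inter> ideals ?B m"
    using assms by (auto simp: ideals_def order_ideal_two_row)
  then have "num_std ?E \<le> (\<Sum>E\<in>ideals ?A m \<inter> ideals ?B m. num_std E)"
    using I by (intro member_le_sum) (auto simp: finite_ideals)
  moreover have "num_std ?E = m - 1" using assms by (intro num_std_two_row_1) simp
  moreover have "(\<Sum>E\<in>ideals ?A m. num_std E) \<le> num_std ?A"
    using assms I by (intro sum_num_std_ideals_le[where k = "a - 1 + b - m"]) auto
  moreover have "(\<Sum>E\<in>ideals ?B m. num_std E) \<le> num_std ?B"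
    using assms I by (intro sum_num_std_ideals_le[where k = "a + (b - 1) - m"]) auto
  moreover have "num_std ?D = num_std ?A + num_std ?B"
    using assms by (intro num_std_two_row_step) auto
  moreover have "(\<Sum>E\<in>ideals ?A m \<union> ideals ?B m. num_std E) + (\<Sum>E\<in>ideals ?A m \<inter> ideals ?B m. num_std E)
      = (\<Sum>E\<in>ideals ?A m. num_std E) + (\<Sum>E\<in>ideals ?B m. num_std E)"
    using I by (intro sum.union_inter) (auto simp: finite_ideals)
  ultimately show ?thesis by linarith
qed


section \<open>Comparing Kostka numbers with numbers of standard tableaux\<close>

text \<open>The entries \<open>1\<close> must fill the beginning of the first row, and the rest is forced.\<close>

lemma kostka_on_two_parts:
  assumes D: "order_ideal D"
  shows "kostka_on D [m, k] = (if two_row m 0 \<in> strips D k then 1 else 0)"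
proof -
  have other: "kostka_on E [m] = 0" if "E \<in> strips D k" "E \<noteq> two_row m 0" for E
  proof (cases "(1, 0) \<in> E")
    case True
    then show ?thesis using stripsD[OF D that(1)] by (intro kostka_on_singleton)
  next
    case False
    have E: "order_ideal E" using stripsD[OF D that(1)] by simp
    then have "E = two_row (card E) 0" using False by (rule order_ideal_eq_row)
    then have "card E \<noteq> m" using that by auto
    then show ?thesis
      using kostka_on_snoc[OF E, of "[]" m] stripsD(3)[OF E, of "{}" m]
      by (auto simp: kostka_on_Nil intro!: sum.neutral)
  qed
  have "kostka_on D ([m] @ [k]) = (\<Sum>E\<in>strips D k. kostka_on E [m])"
    by (rule kostka_on_snoc[OF D])
  also have "\<dots> = (\<Sum>E\<in>strips D k. if E = two_row m 0 then 1 else 0)"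
    using other kostka_on_row[of "[m]" m] by (intro sum.cong) auto
  also have "\<dots> = (if two_row m 0 \<in> strips D k then 1 else 0)"
    using finite_strips[OF D] by simp
  finally show ?thesis by simp
qed

text \<open>For \<open>l + 2\<close> parts with smallest part \<open>k\<close> and sum \<open>m + k\<close>, the first hypothesis holds since the other
  \<open>l + 1\<close> parts are at least \<open>k\<close>. It gives \<open>l / (m - 1) \<le> (l + 1) / (m + k - 1)\<close>, so a bound
  \<open>x / y \<le> l / (m - 1)\<close> survives the addition of the part \<open>k\<close>.\<close>

lemma ratio_step:
  fixes k l m x y :: nat
  assumes "k * Suc l \<le> m" "k > 0" "(m - 1) * x \<le> l * y" "m \<ge> 2"
  shows "(m + k - 1) * x \<le> Suc l * y"
proof -
  have le: "l * (m + k - 1) \<le> Suc l * (m - 1)"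
  proof -
    obtain p where m: "m = Suc p" using assms(4) by (cases m) auto
    have "k * l \<le> p" using assms(1,2) m by (simp add: add_mult_distrib2)
    then show ?thesis using m by (simp add: algebra_simps)
  qed
  have "(m - 1) * ((m + k - 1) * x) = (m + k - 1) * ((m - 1) * x)" by (simp only: ac_simps)
  also have "\<dots> \<le> (m + k - 1) * (l * y)" using assms(3) by (intro mult_le_mono2)
  also have "\<dots> = l * (m + k - 1) * y" by (simp only: ac_simps)
  also have "\<dots> \<le> Suc l * (m - 1) * y" using le by (intro mult_le_mono1)
  also have "\<dots> = (m - 1) * (Suc l * y)" by (simp only: ac_simps)
  finally show ?thesis using assms(4) by simp
qed

text \<open>The central inequality, an equality for \<open>D\<close> of shape \<open>(n - 1, 1)\<close>. The pair \<open>(2, 2)\<close>, \<open>(2, 2)\<close>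
  is a counterexample. Contents that begin with three parts \<open>2\<close> are left out, because in the
  induction they would rest on this pair; shorter initial segments of admissible contents stay
  admissible, apart from \<open>(2, 2)\<close>, and after \<open>(2, 2)\<close> the next part can only be \<open>1\<close>.\<close>

lemma kostka_num_std_le:
  assumes "order_ideal D" "(1, 0) \<in> D" "card D = sum_list mu"
    and "sorted_wrt (\<ge>) mu" "\<forall>x\<in>set mu. x > 0"
    and "take 3 mu \<noteq> [2, 2, 2]" "\<not> (mu = [2, 2] \<and> D = two_row 2 2)"
  shows "(card D - 1) * kostka_on D mu \<le> (length mu - 1) * num_std D"
  using assms
proof (induction mu arbitrary: D rule: rev_induct)
  case Nil
  then show ?case by (auto simp: order_ideal_finite)
next
  case (snoc k mu)
  note D = snoc.prems(1)
  define m where "m = sum_list mu"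
  define S where "S = strips D k"
  have k: "k > 0" and card_D: "card D = m + k" using snoc.prems by (auto simp: m_def)
  have mu: "sorted_wrt (\<ge>) mu" "\<forall>x\<in>set mu. k \<le> x" "\<forall>x\<in>set mu. 0 < x"
    using snoc.prems by (auto simp: sorted_wrt_append)
  have m_ge: "k * length mu \<le> m"
    using mu(2) unfolding m_def by (induction mu) auto
  have S: "order_ideal E" "E \<subseteq> D" "card E = m" if "E \<in> S" for E
    using stripsD[OF D that[unfolded S_def]] card_D by auto
  have fin_S: "finite S" unfolding S_def by (rule finite_strips[OF D])
  have kostka_D: "kostka_on D (mu @ [k]) = (\<Sum>E\<in>S. kostka_on E mu)"
    unfolding S_def by (rule kostka_on_snoc[OF D])
  have S_ideals: "S \<subseteq> ideals D m" unfolding S_def by (rule strips_subset_ideals[OF D card_D])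
  have std_S: "(\<Sum>E\<in>S. num_std E) \<le> num_std D"
    using sum_mono2[OF finite_ideals[OF D] S_ideals, of num_std]
      sum_num_std_ideals_le[OF D card_D] by simp
  show ?case
  proof (cases mu rule: rev_cases)
    case Nil
    then show ?thesis using kostka_on_singleton[OF D snoc.prems(2)] by simp
  next
    case (snoc mu0 k0)
    then obtain l where l: "length mu = Suc l" by simp
    have take_mu: "take 3 mu \<noteq> [2, 2, 2]"
    proof
      assume *: "take 3 mu = [2, 2, 2]"
      then have "length (take 3 mu) = 3" by simp
      then have "take 3 (mu @ [k]) = take 3 mu" by simp
      then show False using * snoc.prems(6) by simp
    qed
    have E_row: "E = two_row m 0" if "E \<in> S" "(1, 0) \<notin> E" for E
      using order_ideal_eq_row[OF S(1)[OF that(1)] that(2)] S(3)[OF that(1)] by simp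
    have IH: "(m - 1) * kostka_on E mu \<le> l * num_std E"
      if "E \<in> S" "E \<noteq> two_row m 0" "\<not> (mu = [2, 2] \<and> E = two_row 2 2)" for E
      using snoc.IH[of E] S[OF that(1)] E_row[OF that(1)] that mu take_mu l m_def by auto
    have IH_sum: "(m - 1) * (\<Sum>E\<in>S - {two_row m 0}. kostka_on E mu)
        \<le> l * (\<Sum>E\<in>S - {two_row m 0}. num_std E)"
      if "mu \<noteq> [2, 2]"
      unfolding sum_distrib_left using IH that by (intro sum_mono) auto
    have m_ge_k: "k \<le> m" using m_ge l by simp
    show ?thesis
    proof (cases "two_row m 0 \<in> S")
      case False
      show ?thesis
      proof (cases "mu = [2, 2]")
        case True
        then have "k = 1" using k mu(2) snoc.prems(6) by (cases "k = 2") auto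
        \<comment> \<open>For \<open>(2, 2, 1)\<close> the target ratio is \<open>2 / 4\<close>, which the exceptional shape attains.\<close>
        have "2 * kostka_on E mu \<le> num_std E" if "E \<in> S" for E
        proof (cases "E = two_row 2 2")
          case True
          have "kostka_on E mu \<le> 1"
            unfolding \<open>mu = [2, 2]\<close> kostka_on_two_parts[OF S(1)[OF that]] by simp
          moreover have "2 \<le> num_std E"
            using num_std_two_row_mono[of 1 2 2] num_std_two_row_1[of 2] True by simp
          ultimately show ?thesis by simp
        next
          case E: False
          have "E \<noteq> two_row m 0" using that \<open>two_row m 0 \<notin> S\<close> by blast
          with E have "(m - 1) * kostka_on E mu \<le> l * num_std E" by (intro IH[OF that]) blast+
          moreover have "m = 4" "l = 1" using True l by (simp_all add: m_def)
          ultimately show ?thesis by simp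
        qed
        then have "2 * kostka_on D (mu @ [k]) \<le> (\<Sum>E\<in>S. num_std E)"
          unfolding kostka_D sum_distrib_left by (rule sum_mono)
        then show ?thesis using std_S True \<open>k = 1\<close> card_D by (simp add: m_def)
      next
        case mu22: False
        show ?thesis
        proof (cases "S = {}")
          case True
          then show ?thesis using kostka_D by simp
        next
          case False
          then obtain E where E: "E \<in> S" by auto
          then have "(1, 0) \<in> E" using E_row \<open>two_row m 0 \<notin> S\<close> by blast
          then have "{(0, 0), (1, 0)} \<subseteq> E" using order_idealD[OF S(1)[OF E], of 1 0 0 0] by simp
          then have "card {(0 :: nat, 0 :: nat), (1, 0)} \<le> card E"
            using S[OF E] by (intro card_mono) (auto simp: order_ideal_finite)
          then have "m \<ge> 2" using S[OF E] by simp
          have "(m - 1) * kostka_on D (mu @ [k]) \<le> l * (\<Sum>E\<in>S. num_std E)"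
            using IH_sum[OF mu22] \<open>two_row m 0 \<notin> S\<close> by (simp add: kostka_D)
          also have "\<dots> \<le> l * num_std D" using std_S by (rule mult_le_mono2)
          finally show ?thesis
            using ratio_step[of k l m "kostka_on D (mu @ [k])" "num_std D"] m_ge k \<open>m \<ge> 2\<close>
            by (simp add: card_D l)
        qed
      qed
    next
      case True
      then have hor: "i = i'" if "(i, j) \<in> D - two_row m 0" "(i', j) \<in> D - two_row m 0" for i i' j
        using that by (auto simp: S_def strips_def)
      \<comment> \<open>The cells outside the row form a horizontal strip, so the first column has at most two cells.\<close>
      have "(2, 0) \<notin> D"
        using hor[of 2 0 1] snoc.prems(2) by auto
      then obtain a b where ab: "b \<le> a" "D = two_row a b" using order_ideal_eq_two_row[OF D] by blast
      have b: "b \<ge> 1" "m \<le> a" "a + b = m + k"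
        using snoc.prems(2) True ab card_D by (auto simp: S_def two_row_in_strips_iff)
      show ?thesis
      proof (cases "b = 1")
        case True
        then have "kostka_on D (mu @ [k]) = length mu"
          using kostka_on_two_row_1[of "mu @ [k]" a] snoc.prems(3,5) ab by simp
        moreover have "num_std D = a" using True ab by (simp add: num_std_two_row_1 del: One_nat_def)
        ultimately show ?thesis using True ab by simp
      next
        case b1: False
        then have b2: "b \<ge> 2" using b by simp
        show ?thesis
        proof (cases l)
          case 0
          then have mu_eq: "mu = [m]" using l by (auto simp: m_def length_Suc_conv)
          have le1: "kostka_on D (mu @ [k]) \<le> 1"
            using kostka_on_two_parts[OF D] mu_eq by simp
          \<comment> \<open>Otherwise \<open>D\<close> and the content are the exceptional pair.\<close>
          have "a \<ge> 3"
          proof (rule ccontr)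
            assume "\<not> a \<ge> 3"
            then have "a = 2" "b = 2" using b2 ab by auto
            moreover from this have "m = 2" "k = 2" using b m_ge_k by auto
            ultimately show False using snoc.prems(7) ab mu_eq by simp
          qed
          then have "a + b - 1 \<le> num_std D"
            using num_std_two_row_ge[OF b2 ab(1)] ab by simp
          then show ?thesis using le1 l 0 ab mult_le_mono[of "a + b - 1" "num_std D" _ 1] by simp
        next
          case (Suc l')
          have "2 * k \<le> m" using m_ge l Suc by simp
          have "mu \<noteq> [2, 2]"
          proof
            assume "mu = [2, 2]"
            then have "k \<le> 2" using mu(2) by simp
            then have "k = 2" using b b2 by simp
            then show False using snoc.prems(6) \<open>mu = [2, 2]\<close> by simp
          qed
          define X where "X = (\<Sum>E\<in>S - {two_row m 0}. num_std E)"
          define x where "x = (\<Sum>E\<in>S - {two_row m 0}. kostka_on E mu)"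
          have "m \<ge> 2" using \<open>2 * k \<le> m\<close> k by simp
          have "(m - 1) * x \<le> l * X" using IH_sum[OF \<open>mu \<noteq> [2, 2]\<close>] by (simp add: X_def x_def)
          then have x: "(m + k - 1) * x \<le> Suc l * X"
            using ratio_step[of k l m x X] m_ge k \<open>m \<ge> 2\<close> l by simp
          \<comment> \<open>The row contributes \<open>1\<close>, which the surplus \<open>m - 1\<close> of standard tableaux has to absorb.\<close>
          have "kostka_on D (mu @ [k]) = 1 + x"
            unfolding kostka_D x_def sum.remove[OF fin_S True]
            using kostka_on_row[of mu m] by (simp add: m_def)
          moreover have "X + (m - 1) \<le> num_std D"
          proof -
            have "X \<le> (\<Sum>E\<in>ideals D m. num_std E)"
              unfolding X_def using S_ideals by (intro sum_mono2 finite_ideals[OF D]) auto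
            moreover have "b < a" using b \<open>2 * k \<le> m\<close> k by linarith
            ultimately show ?thesis
              using num_std_two_row_surplus[OF b2 _ \<open>m \<ge> 2\<close> b(2)] b k ab by simp
          qed
          moreover have "m + k - 1 \<le> Suc l * (m - 1)"
          proof -
            have "m + k - 1 \<le> 2 * (m - 1)" using \<open>2 * k \<le> m\<close> k by linarith
            also have "\<dots> \<le> Suc l * (m - 1)" using Suc by (intro mult_le_mono1) simp
            finally show ?thesis .
          qed
          ultimately have "(m + k - 1) * kostka_on D (mu @ [k]) \<le> Suc l * (X + (m - 1))"
            using x by (simp add: add_mult_distrib2)
          also have "\<dots> \<le> Suc l * num_std D"
            using \<open>X + (m - 1) \<le> num_std D\<close> by (rule mult_le_mono2)
          finally show ?thesis by (simp add: card_D l)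
        qed
      qed
    qed
  qed
qed

section \<open>Young diagrams of partitions\<close>

lemma ssyt_eq_tableaux: "ssyt lam mu = tableaux (young_diagram lam) mu"
  by (simp add: ssyt_def tableaux_def)

lemma kostka_eq: "kostka lam mu = kostka_on (young_diagram lam) mu"
  by (simp add: kostka_def kostka_on_def ssyt_eq_tableaux)

lemma card_young_diagram: "card (young_diagram lam) = sum_list lam"
proof -
  have "young_diagram lam = (SIGMA i:{0..<length lam}. {..<lam ! i})"
    by (auto simp: young_diagram_def)
  then show ?thesis by (simp add: sum_list_sum_nth)
qed

text \<open>Standard tableaux are the semistandard ones in which each entry occurs once: the entries are then
  distinct, so the rows increase strictly.\<close>

lemma num_syt_eq: "num_syt lam = num_std (young_diagram lam)"
proof -
  let ?D = "young_diagram lam" and ?n = "sum_list lam"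
  have "T \<in> syt lam \<longleftrightarrow> T \<in> tableaux ?D (replicate ?n 1)" for T
  proof
    assume T: "T \<in> syt lam"
    then have bij: "bij_betw T ?D {1..?n}" by (simp add: syt_def)
    have "card {c \<in> ?D. T c = Suc m} = 1" if "m < ?n" for m
    proof -
      have "Suc m \<in> T ` ?D" using bij that by (auto simp: bij_betw_def)
      then obtain c where "c \<in> ?D" "T c = Suc m" by auto
      then have "{c \<in> ?D. T c = Suc m} = {c}" using bij by (auto simp: bij_betw_def inj_on_def)
      then show ?thesis by simp
    qed
    then show "T \<in> tableaux ?D (replicate ?n 1)"
      using T by (auto simp: syt_def tableaux_def less_imp_le)
  next
    assume T: "T \<in> tableaux ?D (replicate ?n 1)"
    then have fn: "T \<in> ?D \<rightarrow>\<^sub>E {1..?n}" and cnt: "\<And>m. m < ?n \<Longrightarrow> card {c \<in> ?D. T c = Suc m} = 1"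
      by (auto simp: tableaux_def)
    have inj: "inj_on T ?D"
    proof (rule inj_onI)
      fix c c' assume c: "c \<in> ?D" "c' \<in> ?D" "T c = T c'"
      have "T c \<in> {1..?n}" using fn c by auto
      then have "card {e \<in> ?D. T e = T c} = 1" using cnt[of "T c - 1"] by auto
      then obtain e where "{e \<in> ?D. T e = T c} = {e}" by (auto simp: card_1_singleton_iff)
      then show "c = c'" using c by (metis (mono_tags, lifting) mem_Collect_eq singletonD)
    qed
    moreover have "T ` ?D = {1..?n}"
      using fn inj by (intro card_subset_eq) (auto simp: card_image card_young_diagram)
    ultimately have "bij_betw T ?D {1..?n}" by (simp add: bij_betw_def)
    moreover have "T (i, j) < T (i, j')" if "(i, j) \<in> ?D" "(i, j') \<in> ?D" "j < j'" for i j j'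
    proof -
      have "T (i, j) \<le> T (i, j')" using T that by (auto simp: tableaux_def)
      moreover have "T (i, j) \<noteq> T (i, j')" using inj that by (auto simp: inj_on_def)
      ultimately show ?thesis by simp
    qed
    ultimately show "T \<in> syt lam" using T fn by (auto simp: syt_def tableaux_def)
  qed
  then have "syt lam = tableaux ?D (replicate ?n 1)" by blast
  then show ?thesis by (simp add: num_syt_def num_std_def kostka_on_def card_young_diagram)
qed

lemma order_ideal_young_diagram:
  assumes "is_partition lam n"
  shows "order_ideal (young_diagram lam)"
  unfolding order_ideal_def
proof (intro conjI allI impI finite_young_diagram)
  fix i j i' j' assume ij: "(i, j) \<in> young_diagram lam" "i' \<le> i" "j' \<le> j"
  then have "lam ! i \<le> lam ! i'"
    using assms by (cases "i' = i") (auto simp: is_partition_def young_diagram_def sorted_wrt_iff_nth_less)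
  then show "(i', j') \<in> young_diagram lam" using ij by (auto simp: young_diagram_def)
qed

lemma young_diagram_two_rows: "young_diagram [a, b] = two_row a b"
  by (auto simp: young_diagram_def less_Suc_eq nth_Cons')

lemma second_row_nonempty:
  assumes "is_partition lam n" "lam \<noteq> [n]" "n > 0"
  shows "(1, 0) \<in> young_diagram lam"
proof -
  obtain x y ys where "lam = x # y # ys"
    using assms by (cases lam rule: remdups_adj.cases) (auto simp: is_partition_def)
  then show ?thesis using assms by (simp add: young_diagram_def is_partition_def)
qed

section \<open>Metatypes of partitions with small sum\<close>

lemma sum_list_metatype: "sum_list (metatype a) = length a"
proof -
  have "sum_list (metatype a) = sum_list (map (count_list a) (remdups a))"
    unfolding metatype_def by (metis mset_rev mset_sort sum_mset_sum_list)
  also have "\<dots> = sum (count_list a) (set a)"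
    by (simp add: sum_list_distinct_conv_sum_set)
  also have "\<dots> = length a" by (rule sum_count_set) auto
  finally show ?thesis .
qed

lemma set_metatype: "set (metatype a) = count_list a ` set a"
  by (simp add: metatype_def)

lemma sorted_metatype: "sorted_wrt (\<ge>) (metatype a)"
  unfolding metatype_def sorted_wrt_rev by simp

lemma metatype_pos: "\<forall>x\<in>set (metatype a). x > 0"
  by (auto simp: set_metatype count_list_0_iff intro!: gr0I)

text \<open>Every entry other than \<open>0\<close> and \<open>1\<close> is at least \<open>2\<close>.\<close>

lemma sum_list_ge_counts: "2 * length a \<le> sum_list a + 2 * count_list a 0 + count_list a 1"
  for a :: "nat list"
  by (induction a) auto

text \<open>A metatype is decreasing, so here no value occurs more than twice; the sum is then at least
  \<open>2 * length a - 6\<close>, and there are at least six entries.\<close>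

lemma metatype_prefix:
  assumes "take 3 (metatype a) = [2, 2, 2]"
  shows "length a \<le> sum_list a"
proof -
  obtain mu where mu: "metatype a = 2 # 2 # 2 # mu"
    using assms append_take_drop_id[of 3 "metatype a"] by (metis append_Cons append_Nil)
  then have "\<forall>x\<in>set (metatype a). x \<le> 2" using sorted_metatype[of a] by auto
  then have "count_list a x \<le> 2" for x
    by (cases "x \<in> set a") (auto simp: set_metatype count_list_0_iff)
  then have "count_list a 0 \<le> 2" "count_list a 1 \<le> 2" by blast+
  moreover have "6 \<le> length a" using sum_list_metatype[of a] mu by simp
  ultimately show ?thesis using sum_list_ge_counts[of a] by linarith
qed

section \<open>Summation over the partitions\<close>

lemma kostka_le_near_row:
  assumes lam: "is_partition lam n" "lam \<noteq> [n]" and n: "n \<ge> 2"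
    and a: "length a = n" "sum_list a < n"
    and exc: "\<not> (metatype a = [2, 2] \<and> young_diagram lam = two_row 2 2)"
  shows "(n - 1) * kostka lam (metatype a) \<le> kostka [n - 1, 1] (metatype a) * num_syt lam"
proof -
  have "take 3 (metatype a) \<noteq> [2, 2, 2]" using metatype_prefix[of a] a by auto
  moreover have "card (young_diagram lam) = n"
    using lam by (simp add: card_young_diagram is_partition_def)
  ultimately have "(n - 1) * kostka lam (metatype a) \<le> (length (metatype a) - 1) * num_syt lam"
    using kostka_num_std_le[of "young_diagram lam" "metatype a"] lam n exc a
      order_ideal_young_diagram[OF lam(1)] second_row_nonempty[OF lam]
    by (simp add: kostka_eq num_syt_eq sum_list_metatype sorted_metatype metatype_pos)
  also have "length (metatype a) - 1 = kostka [n - 1, 1] (metatype a)"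
    using n a by (simp only: kostka_eq young_diagram_two_rows)
      (subst kostka_on_two_row_1[OF metatype_pos], auto simp: sum_list_metatype)
  finally show ?thesis .
qed

text \<open>Two distinct values, each taken twice, with sum below \<open>4\<close> must be \<open>1\<close> and \<open>0\<close>.\<close>

lemma metatype_eq_2_2:
  assumes "length a = 4" "sorted_wrt (\<ge>) a" "sum_list a < 4" "metatype a = [2, 2]"
  shows "a = [1, 1, 0, 0]"
proof -
  obtain p q r s where a: "a = [p, q, r, s]"
    using assms(1) by (auto simp: numeral_eq_Suc length_Suc_conv)
  have "set (metatype a) = {2}" using assms(4) by simp
  then have cnt: "count_list a x = 2" if "x \<in> set a" for x
    using that unfolding set_metatype by blast
  have "p \<in> set a" "s \<in> set a" by (simp_all add: a)
  then have "count_list a p = 2" "count_list a s = 2" using cnt by blast+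
  then have "p = q" "r = s" "q \<noteq> r"
    using assms(2) unfolding a by (auto split: if_splits)
  then show ?thesis using assms(2,3) a by auto
qed

text \<open>For \<open>d < 4\<close> the exceptional content occurs only if \<open>d = 2\<close>. There the contents are \<open>(3, 1)\<close> and \<open>(2, 2)\<close>; the
  shape \<open>(2, 2)\<close> has Kostka numbers \<open>0\<close> and \<open>1\<close>, the shape \<open>(3, 1)\<close> has \<open>1\<close> and \<open>1\<close>, and the claim becomes
  \<open>3 * 1 \<le> 2 * 2\<close>.\<close>

lemma F_2_2_le:
  assumes lam: "is_partition lam 4" "young_diagram lam = two_row 2 2" and "d < 4"
  shows "3 * F lam d \<le> F [3, 1] d * num_syt lam"
proof (cases "d = 2")
  case False
  have "lam \<noteq> [4]"
  proof
    assume "lam = [4]"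
    then have "(0, 2) \<in> two_row 2 2" unfolding lam(2)[symmetric] by (simp add: young_diagram_def)
    then show False by simp
  qed
  have "3 * kostka lam (metatype a) \<le> kostka [3, 1] (metatype a) * num_syt lam"
    if "a \<in> padded_partitions 4 d" for a
  proof -
    have a: "length a = 4" "sorted_wrt (\<ge>) a" "sum_list a = d"
      using that by (auto simp: padded_partitions_def)
    then have "metatype a \<noteq> [2, 2]" using metatype_eq_2_2[of a] False \<open>d < 4\<close> by auto
    then show ?thesis using kostka_le_near_row[of lam 4 a] lam \<open>lam \<noteq> [4]\<close> a \<open>d < 4\<close> by simp
  qed
  then show ?thesis
    using lam(1) by (simp add: F_def is_partition_def sum_distrib_left sum_distrib_right sum_mono)
next
  case True
  have "padded_partitions 4 2 = {[2, 0, 0, 0], [1, 1, 0, 0]}"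
  proof (intro equalityI subsetI)
    fix a assume "a \<in> padded_partitions 4 2"
    then have a: "length a = 4" "sorted_wrt (\<ge>) a" "sum_list a = 2"
      by (auto simp: padded_partitions_def)
    then obtain p q r s where pqrs: "a = [p, q, r, s]"
      by (auto simp: numeral_eq_Suc length_Suc_conv)
    then have "p = 2 \<and> q = 0 \<and> r = 0 \<and> s = 0 \<or> p = 1 \<and> q = 1 \<and> r = 0 \<and> s = 0"
      using a by auto
    then show "a \<in> {[2, 0, 0, 0], [1, 1, 0, 0]}" using pqrs by auto
  qed (auto simp: padded_partitions_def)
  moreover have "metatype [2, 0, 0, 0] = [3, 1]" "metatype [1, 1, 0, 0] = [2, 2]"
    by (simp_all add: metatype_def)
  ultimately have F: "F mu 2 = kostka mu [3, 1] + kostka mu [2, 2]" if "sum_list mu = 4" for mu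
    using that by (simp add: F_def)
  have I: "order_ideal (two_row 2 2)" by (simp add: order_ideal_two_row)
  have "kostka lam [3, 1] = 0" "kostka lam [2, 2] = 1"
    unfolding kostka_eq lam(2) kostka_on_two_parts[OF I] by (simp_all add: two_row_in_strips_iff)
  then have "F lam 2 = 1" using F[of lam] lam(1) by (simp add: is_partition_def)
  moreover have "F [3, 1] 2 = 2"
    using F[of "[3, 1]"] kostka_on_two_row_1[of "[3, 1]" 3] kostka_on_two_row_1[of "[2, 2]" 3]
    by (simp add: kostka_eq young_diagram_two_rows)
  moreover have "2 \<le> num_syt lam"
    using num_std_two_row_mono[of 1 2 2] num_std_two_row_1[of 2] by (simp add: num_syt_eq lam(2))
  ultimately show ?thesis using True by simp
qed

lemma F_le_near_row:
  assumes n: "n \<ge> 2" and lam: "is_partition lam n" "lam \<noteq> [n]" and d: "d < n"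
  shows "(n - 1) * F lam d \<le> F [n - 1, 1] d * num_syt lam"
proof (cases "young_diagram lam = two_row 2 2")
  case True
  then have "n = 4" using lam card_young_diagram[of lam] by (simp add: is_partition_def)
  then show ?thesis using F_2_2_le[of lam d] True lam d by simp
next
  case False
  have "(n - 1) * kostka lam (metatype a) \<le> kostka [n - 1, 1] (metatype a) * num_syt lam"
    if "a \<in> padded_partitions n d" for a
    using kostka_le_near_row[OF lam n, of a] that False d by (simp add: padded_partitions_def)
  then show ?thesis
    using lam(1) n
    by (simp add: F_def is_partition_def sum_distrib_left sum_distrib_right sum_mono
        del: diff_mult_distrib)
qed

theorem proposition4p4:
  fixes n d :: nat and lam :: "nat list"
  assumes "n \<ge> 2"
    and "is_partition lam n"
    and "lam \<noteq> [n]"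
    and "n > d"
  shows "real (F [n - 1, 1] d) / real (num_syt [n - 1, 1]) \<ge> real (F lam d) / real (num_syt lam)"
proof -
  have std: "num_syt [n - 1, 1] = n - 1"
    using assms(1) by (simp only: num_syt_eq young_diagram_two_rows num_std_two_row_1)
  have "real ((n - 1) * F lam d) \<le> real (F [n - 1, 1] d * num_syt lam)"
    using F_le_near_row[OF assms(1-4)] by (simp only: of_nat_le_iff)
  then show ?thesis
    unfolding std using assms(1)
    by (cases "num_syt lam = 0") (simp_all add: field_simps del: of_nat_diff)
qed

end
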